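(* Consider the following conditions. (i) There exists a point $x_0\in B_4\cup B_5=\{x\in\mathcal I: f(x)\vee g(x)<h(x)\}$ with $$\sup_{\tau<\tau^{(B_4\cup B_5)^c}}\mathbb E_{x_0}\big(e^{-r\tau}f(X_\tau)\big)>f(x_0)\vee g(x_0).$$ (ii) There exists a point $x_0\in B_3\cup B_6=\{x\in\mathcal I: h(x)<f(x)\wedge g(x)\}$ with $$\inf_{\tau<\tau^{(B_3\cup B_6)^c}}\mathbb E_{x_0}\big(e^{-r\tau}g(X_\tau)\big)<f(x_0)\wedge g(x_0).$$ If (i) or (ii) holds, then no global Markovian pure Nash equilibrium exists.
   Context: Setting. $\mathcal I=(\alpha,\beta)$, $-\infty\le\alpha<\beta\le\infty$. $X$ is a regular one-dimensional diffusion on $\mathcal I$ solving $dX_t=\mu(X_t)dt+\sigma(X_t)dW_t$, $X_0=x$, where $\mu:\mathcal I\to\mathbb R$ and $\sigma:\mathcal I\to(0,\infty)$ are continuous, $W$ is a standard Wiener process on a complete filtered probability space satisfying the usual conditions, and the SDE has a weak solution unique in law; $\mathbb P_x,\mathbb E_x$ refer to $X_0=x$. $\mathcal F^X$ is the smallest filtration to which $X$ is adapted satisfying the usual conditions. $r\ge0$ is a constant and $f,g,h:\mathcal I\to\mathbb R$ are continuous. Topological notions for subsets of $\mathcal I$ are taken in $\mathcal I$; $\partial B$ and $B^c$ are the boundary and the complement (in $\mathcal I$) of $B$; $\tau^B:=\inf\{t\ge0:X_t\in B\}$; $\inf\emptyset=\infty$. Points of a set $P\subseteq\mathcal I$ are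 "separated" if $P\cap A$ is finite for each compact $A\subseteq\mathcal I$. Sets: $B_1=\{g\le h\le f\}$, $B_2=\{f\le h<g\}\cup\{f<h\le g\}$, $B_3=\{h<g<f\}$, $B_4=\{g<f<h\}$, $B_5=\{f\le g<h\}$, $B_6=\{h<f\le g\}$ (subsets of $\mathcal I$). Standing assumptions. (a) Each of $f,g,h$ is a difference of convex functions. (b) The points in $\bigcup_i\partial B_i$ are separated. (c) The boundaries of $\mathcal I$ are natural. (d) $\mathbb P_x$-a.s., $e^{-rt}f(X_t),e^{-rt}g(X_t),e^{-rt}h(X_t)\to0$ as $t\to\infty$; by convention $e^{-r\tau}w(X_\tau):=0$ on $\{\tau=\infty\}$ for any $w:\mathcal I\to\mathbb R$; and $\mathbb E_x(\sup_{t\ge0}e^{-rt}|f(X_t)|+\sup_{t\ge0}e^{-rt}|g(X_t)|+\sup_{t\ge0}e^{-rt}|h(X_t)|)<\infty$ for each $x$. (e) For $w\in\{f,g\}$ let $(\mathbb K_X-r)w$ be the signed measure $\mu(x)w'_-(x)dx+\frac12\sigma^2(x)w''(dx)-rw(x)dx$ ($w'_-$ left derivative, $w''$ second derivative measure), with Jordan decomposition $((\mathbb K_X-r)w)^+-((\mathbb K_X-r)w)^-$; the points in the boundary of the support of each of $((\mathbb K_X-r)f)^\pm$, $((\mathbb K_X-r)g)^\pm$ are separated. Game. $\mathbb T_i$ ($i=1,2$) is the set of admissible stopping times $\tau_i=\inf\{t\ge0:\Psi^{(i)}_t\ge E_i\}$, where $\Psi^{(i)}$ is a non-decreasing, right-continuous,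 $\mathcal F^X$-adapted $[0,\infty]$-valued process with $\Psi^{(i)}_{0-}=0$ and $E_i$ is $Exp(1)$-distributed and independent of all other random sources. A Markovian pure stopping time is a first entry time $\tau^{D}$ with $D\subseteq\mathcal I$ measurable. Player 1 maximizes and Player 2 minimizes $$J(x;\tau_1,\tau_2)=\mathbb E_x\big(e^{-r(\tau_1\wedge\tau_2)}(f(X_{\tau_1})\mathbb I\{\tau_1<\tau_2\}+g(X_{\tau_2})\mathbb I\{\tau_1>\tau_2\}+h(X_{\tau_1})\mathbb I\{\tau_1=\tau_2\})\big).$$ A pair $(\tau_1^*,\tau_2^* )$ of Markovian pure stopping times is a global Markovian pure Nash equilibrium if $J(x;\tau_1,\tau_2^* )\le J(x;\tau_1^*,\tau_2^* )\le J(x;\tau_1^*,\tau_2)$ for all $\tau_1\in\mathbb T_1$, $\tau_2\in\mathbb T_2$, $x\in\mathcal I$. In condition (i) the supremum is over admissible stopping times $\tau\in\mathbb T_1$ with $\tau<\tau^{(B_4\cup B_5)^c}$, and in condition (ii) the infimum is over admissible stopping times $\tau\in\mathbb T_2$ with $\tau<\tau^{(B_3\cup B_6)^c}$. *)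

theory Defs
  imports "HOL-Probability.Probability"
begin

section \<open>Filtrations\<close>

text \<open>
  Time is \<^term>\<open>{0..}::real set\<close>; the filtrations of the library are indexed by the whole type,
  so their values at negative times are present but never used.
\<close>

definition usual_filtration :: "'w measure \<Rightarrow> (real \<Rightarrow> 'w measure) \<Rightarrow> bool" where
  "usual_filtration M F \<longleftrightarrow>
     filtration (space M) F \<and> (\<forall>t\<ge>0. subalgebra M (F t)) \<and>
     complete_measure M \<and> (\<forall>t\<ge>0. null_sets M \<subseteq> sets (F t)) \<and>
     (\<forall>t\<ge>0. sets (F t) = (\<Inter>s\<in>{t<..}. sets (F s)))"

definition adapted :: "(real \<Rightarrow> 'w measure) \<Rightarrow> (real \<Rightarrow> 'w \<Rightarrow> 'b::topological_space) \<Rightarrow> bool" where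
  "adapted F X \<longleftrightarrow> (\<forall>t\<ge>0. X t \<in> borel_measurable (F t))"

text \<open>The smallest filtration satisfying the usual conditions to which \<open>X\<close> is adapted.\<close>

definition augmented_filtration ::
    "'w measure \<Rightarrow> (real \<Rightarrow> 'w \<Rightarrow> real) \<Rightarrow> real \<Rightarrow> 'w measure" where
  "augmented_filtration M X t =
     sigma (space M) {A \<in> sets M. \<forall>G. usual_filtration M G \<and> adapted G X \<longrightarrow> A \<in> sets (G t)}"


section \<open>Wiener processes and the Ito integral\<close>

definition continuous_paths :: "'w measure \<Rightarrow> (real \<Rightarrow> 'w \<Rightarrow> real) \<Rightarrow> bool" where
  "continuous_paths M X \<longleftrightarrow> (\<forall>\<omega>\<in>space M. continuous_on {0..} (\<lambda>t. X t \<omega>))"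

definition wiener_process ::
    "'w measure \<Rightarrow> (real \<Rightarrow> 'w measure) \<Rightarrow> (real \<Rightarrow> 'w \<Rightarrow> real) \<Rightarrow> bool" where
  "wiener_process M F W \<longleftrightarrow>
     adapted F W \<and> continuous_paths M W \<and> (AE \<omega> in M. W 0 \<omega> = 0) \<and>
     (\<forall>s\<ge>0. \<forall>t>s.
        distributed M lborel (\<lambda>\<omega>. W t \<omega> - W s \<omega>) (normal_density 0 (sqrt (t - s))) \<and>
        prob_space.indep_set M (sets (F s))
          {(\<lambda>\<omega>. W t \<omega> - W s \<omega>) -` B \<inter> space M | B. B \<in> sets borel})"

text \<open>
  The data \<open>(n, p, \<xi>)\<close> stand for the simple integrand that equals \<open>\<xi> i\<close> on
  \<open>{p i <.. p (Suc i)}\<close> for \<open>i < n\<close> and \<open>0\<close> elsewhere.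
\<close>

definition simple_integrand ::
    "'w measure \<Rightarrow> (real \<Rightarrow> 'w measure) \<Rightarrow> nat \<Rightarrow> (nat \<Rightarrow> real) \<Rightarrow> (nat \<Rightarrow> 'w \<Rightarrow> real) \<Rightarrow> bool" where
  "simple_integrand M F n p \<xi> \<longleftrightarrow>
     0 \<le> p 0 \<and> (\<forall>i<n. p i \<le> p (Suc i)) \<and>
     (\<forall>i<n. \<xi> i \<in> borel_measurable (F (p i)) \<and> (\<exists>K. \<forall>\<omega>\<in>space M. \<bar>\<xi> i \<omega>\<bar> \<le> K))"

definition simple_value ::
    "nat \<Rightarrow> (nat \<Rightarrow> real) \<Rightarrow> (nat \<Rightarrow> 'w \<Rightarrow> real) \<Rightarrow> real \<Rightarrow> 'w \<Rightarrow> real" where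
  "simple_value n p \<xi> s \<omega> = (\<Sum>i<n. \<xi> i \<omega> * indicator {p i<..p (Suc i)} s)"

definition simple_integral ::
    "nat \<Rightarrow> (nat \<Rightarrow> real) \<Rightarrow> (nat \<Rightarrow> 'w \<Rightarrow> real) \<Rightarrow> (real \<Rightarrow> 'w \<Rightarrow> real) \<Rightarrow> real \<Rightarrow> 'w \<Rightarrow> real" where
  "simple_integral n p \<xi> W t \<omega> =
     (\<Sum>i<n. \<xi> i \<omega> * (W (min t (p (Suc i))) \<omega> - W (min t (p i)) \<omega>))"

definition null_in_probability :: "'w measure \<Rightarrow> (nat \<Rightarrow> 'w \<Rightarrow> ennreal) \<Rightarrow> bool" where
  "null_in_probability M Z \<longleftrightarrow>
     (\<forall>\<epsilon>>0. (\<lambda>k. measure M {\<omega>\<in>space M. ennreal \<epsilon> < Z k \<omega>}) \<longlonglongrightarrow> 0)"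

definition progressively_measurable ::
    "(real \<Rightarrow> 'w measure) \<Rightarrow> (real \<Rightarrow> 'w \<Rightarrow> real) \<Rightarrow> bool" where
  "progressively_measurable F H \<longleftrightarrow>
     (\<forall>T\<ge>0. (\<lambda>(s, \<omega>). H s \<omega>) \<in> borel_measurable (restrict_space borel {0..T} \<Otimes>\<^sub>M F T))"

text \<open>\<open>Y\<close> is (a continuous version of) the Ito integral of \<open>H\<close> with respect to \<open>W\<close>.\<close>

definition has_ito_integral ::
    "'w measure \<Rightarrow> (real \<Rightarrow> 'w measure) \<Rightarrow> (real \<Rightarrow> 'w \<Rightarrow> real) \<Rightarrow>
     (real \<Rightarrow> 'w \<Rightarrow> real) \<Rightarrow> (real \<Rightarrow> 'w \<Rightarrow> real) \<Rightarrow> bool" where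
  "has_ito_integral M F W H Y \<longleftrightarrow>
     progressively_measurable F H \<and>
     (AE \<omega> in M. \<forall>T\<ge>0. (\<integral>\<^sup>+s\<in>{0..T}. ennreal ((H s \<omega>)\<^sup>2) \<partial>lborel) < \<infinity>) \<and>
     adapted F Y \<and> continuous_paths M Y \<and>
     (\<exists>n p \<xi>. (\<forall>k. simple_integrand M F (n k) (p k) (\<xi> k)) \<and>
        (\<forall>T\<ge>0.
           null_in_probability M (\<lambda>k \<omega>.
             \<integral>\<^sup>+s\<in>{0..T}. ennreal ((simple_value (n k) (p k) (\<xi> k) s \<omega> - H s \<omega>)\<^sup>2) \<partial>lborel) \<and>
           null_in_probability M (\<lambda>k \<omega>.
             SUP t\<in>{0..T}. ennreal \<bar>simple_integral (n k) (p k) (\<xi> k) W t \<omega> - Y t \<omega>\<bar>)))"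


section \<open>The diffusion\<close>

definition first_entry :: "(real \<Rightarrow> 'w \<Rightarrow> real) \<Rightarrow> real set \<Rightarrow> 'w \<Rightarrow> ennreal" where
  "first_entry X B \<omega> = (INF t\<in>{t. 0 \<le> t \<and> X t \<omega> \<in> B}. ennreal t)"

definition weak_solution ::
    "real set \<Rightarrow> (real \<Rightarrow> real) \<Rightarrow> (real \<Rightarrow> real) \<Rightarrow> real \<Rightarrow> 'w measure \<Rightarrow>
     (real \<Rightarrow> 'w measure) \<Rightarrow> (real \<Rightarrow> 'w \<Rightarrow> real) \<Rightarrow> (real \<Rightarrow> 'w \<Rightarrow> real) \<Rightarrow> bool" where
  "weak_solution I \<mu> \<sigma> x M F W X \<longleftrightarrow>
     prob_space M \<and> usual_filtration M F \<and> wiener_process M F W \<and>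
     adapted F X \<and> continuous_paths M X \<and> (\<forall>\<omega>\<in>space M. \<forall>t\<ge>0. X t \<omega> \<in> I) \<and>
     (AE \<omega> in M. X 0 \<omega> = x) \<and>
     (\<exists>Y. has_ito_integral M F W (\<lambda>t \<omega>. \<sigma> (X t \<omega>)) Y \<and>
        (AE \<omega> in M. \<forall>t\<ge>0. X t \<omega> = X 0 \<omega> + (LBINT s:{0..t}. \<mu> (X s \<omega>)) + Y t \<omega>))"

definition path_law :: "'w measure \<Rightarrow> (real \<Rightarrow> 'w \<Rightarrow> real) \<Rightarrow> (real \<Rightarrow> real) measure" where
  "path_law M X = distr M (\<Pi>\<^sub>M t\<in>{0..}. borel) (\<lambda>\<omega>. \<lambda>t\<in>{0..}. X t \<omega>)"

text \<open>
  A proposition cannot quantify over types, so the competing solutions live on spaces over one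
  fixed sample type, passed as a type argument.
\<close>

definition unique_in_law ::
    "'w itself \<Rightarrow> real set \<Rightarrow> (real \<Rightarrow> real) \<Rightarrow> (real \<Rightarrow> real) \<Rightarrow> bool" where
  "unique_in_law TYPE('w) I \<mu> \<sigma> \<longleftrightarrow>
     (\<forall>x\<in>I. \<forall>(M::'w measure) F W X (M'::'w measure) F' W' X'.
        weak_solution I \<mu> \<sigma> x M F W X \<and> weak_solution I \<mu> \<sigma> x M' F' W' X' \<longrightarrow>
        path_law M X = path_law M' X')"

text \<open>
  The family \<open>M x, X x\<close> realises the process started at \<open>x\<close>, for each \<open>x \<in> I\<close>.
\<close>

definition strong_markov ::
    "real set \<Rightarrow> (real \<Rightarrow> 'w measure) \<Rightarrow> (real \<Rightarrow> real \<Rightarrow> 'w \<Rightarrow> real) \<Rightarrow> bool" where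
  "strong_markov I M X \<longleftrightarrow>
     (\<forall>t\<ge>0. \<forall>B\<in>sets borel.
        (\<lambda>y. measure (M y) {\<omega>\<in>space (M y). X y t \<omega> \<in> B})
          \<in> borel_measurable (restrict_space borel I) \<and>
        (\<forall>x\<in>I. \<forall>\<tau> :: 'w \<Rightarrow> ennreal. \<forall>A\<in>sets (M x).
           (\<forall>s\<ge>0. {\<omega>\<in>space (M x). \<tau> \<omega> \<le> ennreal s} \<in> sets (augmented_filtration (M x) (X x) s)) \<and>
           (\<forall>s\<ge>0. A \<inter> {\<omega>\<in>space (M x). \<tau> \<omega> \<le> ennreal s}
                    \<in> sets (augmented_filtration (M x) (X x) s)) \<longrightarrow>
           measure (M x) {\<omega>\<in>A. \<tau> \<omega> < \<infinity> \<and> X x (enn2real (\<tau> \<omega>) + t) \<omega> \<in> B} =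
           (LINT \<omega>:{\<omega>\<in>A. \<tau> \<omega> < \<infinity>}|M x.
              (let y = X x (enn2real (\<tau> \<omega>)) \<omega>
               in measure (M y) {\<omega>'\<in>space (M y). X y t \<omega>' \<in> B}))))"

definition regular_diffusion ::
    "real set \<Rightarrow> (real \<Rightarrow> 'w measure) \<Rightarrow> (real \<Rightarrow> real \<Rightarrow> 'w \<Rightarrow> real) \<Rightarrow> bool" where
  "regular_diffusion I M X \<longleftrightarrow>
     strong_markov I M X \<and>
     (\<forall>x\<in>I. continuous_paths (M x) (X x)) \<and>
     (\<forall>x\<in>I. \<forall>y\<in>I. measure (M x) {\<omega>\<in>space (M x). first_entry (X x) {y} \<omega> < \<infinity>} > 0)"

text \<open>
  Scale and speed densities, normalised at \<open>c\<close>. A boundary is natural if it is neither an exit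
  nor an entrance boundary, i.e. if both of Feller's integrals diverge.
\<close>

definition scale_density :: "(real \<Rightarrow> real) \<Rightarrow> (real \<Rightarrow> real) \<Rightarrow> real \<Rightarrow> real \<Rightarrow> real" where
  "scale_density \<mu> \<sigma> c y = exp (- (LBINT u=ereal c..ereal y. 2 * \<mu> u / (\<sigma> u)\<^sup>2))"

definition speed_density :: "(real \<Rightarrow> real) \<Rightarrow> (real \<Rightarrow> real) \<Rightarrow> real \<Rightarrow> real \<Rightarrow> real" where
  "speed_density \<mu> \<sigma> c y = 2 / ((\<sigma> y)\<^sup>2 * scale_density \<mu> \<sigma> c y)"

definition natural_left :: "ereal \<Rightarrow> ereal \<Rightarrow> (real \<Rightarrow> real) \<Rightarrow> (real \<Rightarrow> real) \<Rightarrow> bool" where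
  "natural_left \<alpha> \<beta> \<mu> \<sigma> \<longleftrightarrow>
     (\<forall>c\<in>einterval \<alpha> \<beta>.
        (\<integral>\<^sup>+y\<in>einterval \<alpha> (ereal c). ennreal (scale_density \<mu> \<sigma> c y) *
           (\<integral>\<^sup>+z\<in>{y..c}. ennreal (speed_density \<mu> \<sigma> c z) \<partial>lborel) \<partial>lborel) = \<infinity> \<and>
        (\<integral>\<^sup>+y\<in>einterval \<alpha> (ereal c). ennreal (speed_density \<mu> \<sigma> c y) *
           (\<integral>\<^sup>+z\<in>{y..c}. ennreal (scale_density \<mu> \<sigma> c z) \<partial>lborel) \<partial>lborel) = \<infinity>)"

definition natural_right :: "ereal \<Rightarrow> ereal \<Rightarrow> (real \<Rightarrow> real) \<Rightarrow> (real \<Rightarrow> real) \<Rightarrow> bool" where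
  "natural_right \<alpha> \<beta> \<mu> \<sigma> \<longleftrightarrow>
     (\<forall>c\<in>einterval \<alpha> \<beta>.
        (\<integral>\<^sup>+y\<in>einterval (ereal c) \<beta>. ennreal (scale_density \<mu> \<sigma> c y) *
           (\<integral>\<^sup>+z\<in>{c..y}. ennreal (speed_density \<mu> \<sigma> c z) \<partial>lborel) \<partial>lborel) = \<infinity> \<and>
        (\<integral>\<^sup>+y\<in>einterval (ereal c) \<beta>. ennreal (speed_density \<mu> \<sigma> c y) *
           (\<integral>\<^sup>+z\<in>{c..y}. ennreal (scale_density \<mu> \<sigma> c z) \<partial>lborel) \<partial>lborel) = \<infinity>)"


section \<open>Conditions on the payoff functions\<close>

definition difference_of_convex :: "real set \<Rightarrow> (real \<Rightarrow> real) \<Rightarrow> bool" where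
  "difference_of_convex I w \<longleftrightarrow>
     (\<exists>u v. convex_on I u \<and> convex_on I v \<and> (\<forall>x\<in>I. w x = u x - v x))"

definition separated_in :: "real set \<Rightarrow> real set \<Rightarrow> bool" where
  "separated_in I P \<longleftrightarrow> (\<forall>A. compact A \<and> A \<subseteq> I \<longrightarrow> finite (P \<inter> A))"

definition B1 :: "real set \<Rightarrow> (real \<Rightarrow> real) \<Rightarrow> (real \<Rightarrow> real) \<Rightarrow> (real \<Rightarrow> real) \<Rightarrow> real set" where
  "B1 I f g h = {x\<in>I. g x \<le> h x \<and> h x \<le> f x}"

definition B2 :: "real set \<Rightarrow> (real \<Rightarrow> real) \<Rightarrow> (real \<Rightarrow> real) \<Rightarrow> (real \<Rightarrow> real) \<Rightarrow> real set" where
  "B2 I f g h = {x\<in>I. f x \<le> h x \<and> h x < g x} \<union> {x\<in>I. f x < h x \<and> h x \<le> g x}"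

definition B3 :: "real set \<Rightarrow> (real \<Rightarrow> real) \<Rightarrow> (real \<Rightarrow> real) \<Rightarrow> (real \<Rightarrow> real) \<Rightarrow> real set" where
  "B3 I f g h = {x\<in>I. h x < g x \<and> g x < f x}"

definition B4 :: "real set \<Rightarrow> (real \<Rightarrow> real) \<Rightarrow> (real \<Rightarrow> real) \<Rightarrow> (real \<Rightarrow> real) \<Rightarrow> real set" where
  "B4 I f g h = {x\<in>I. g x < f x \<and> f x < h x}"

definition B5 :: "real set \<Rightarrow> (real \<Rightarrow> real) \<Rightarrow> (real \<Rightarrow> real) \<Rightarrow> (real \<Rightarrow> real) \<Rightarrow> real set" where
  "B5 I f g h = {x\<in>I. f x \<le> g x \<and> g x < h x}"

definition B6 :: "real set \<Rightarrow> (real \<Rightarrow> real) \<Rightarrow> (real \<Rightarrow> real) \<Rightarrow> (real \<Rightarrow> real) \<Rightarrow> real set" where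
  "B6 I f g h = {x\<in>I. h x < f x \<and> f x \<le> g x}"

lemma B4_Un_B5: "B4 I f g h \<union> B5 I f g h = {x\<in>I. max (f x) (g x) < h x}"
  unfolding B4_def B5_def by (auto simp: max_def)

lemma B3_Un_B6: "B3 I f g h \<union> B6 I f g h = {x\<in>I. h x < min (f x) (g x)}"
  unfolding B3_def B6_def by (auto simp: min_def)

definition left_deriv :: "(real \<Rightarrow> real) \<Rightarrow> real \<Rightarrow> real" where
  "left_deriv w x = vector_derivative w (at_left x)"

definition radon_on :: "real set \<Rightarrow> real measure \<Rightarrow> bool" where
  "radon_on I \<nu> \<longleftrightarrow> sets \<nu> = sets (restrict_space borel I) \<and>
     (\<forall>A. compact A \<and> A \<subseteq> I \<longrightarrow> emeasure \<nu> A < \<infinity>)"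

text \<open>
  A signed Radon measure on \<open>I\<close> need not be defined on all Borel subsets of \<open>I\<close> (both parts may be
  infinite); it is represented as a difference \<open>P - N\<close> of two Radon measures, evaluated on Borel
  sets contained in a compact interval of \<open>I\<close>.  For convex \<open>w\<close> the second derivative measure has
  mass \<open>w'\<^sub>-(b) - w'\<^sub>-(a)\<close> on \<open>[a, b)\<close>.
\<close>

definition second_derivative_measure ::
    "real set \<Rightarrow> (real \<Rightarrow> real) \<Rightarrow> real measure \<Rightarrow> real measure \<Rightarrow> bool" where
  "second_derivative_measure I w P N \<longleftrightarrow> radon_on I P \<and> radon_on I N \<and>
     (\<forall>a\<in>I. \<forall>b\<in>I. a < b \<longrightarrow>
        measure P {a..<b} - measure N {a..<b} = left_deriv w b - left_deriv w a)"

text \<open>The value \<open>((K\<^sub>X - r) w)(A)\<close>, where \<open>P - N\<close> is the second derivative measure of \<open>w\<close>.\<close>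

definition generator_measure ::
    "(real \<Rightarrow> real) \<Rightarrow> (real \<Rightarrow> real) \<Rightarrow> real \<Rightarrow> (real \<Rightarrow> real) \<Rightarrow>
     real measure \<Rightarrow> real measure \<Rightarrow> real set \<Rightarrow> real" where
  "generator_measure \<mu> \<sigma> r w P N A =
     (LBINT x:A. \<mu> x * left_deriv w x)
     + 1 / 2 * ((LINT x:A|P. (\<sigma> x)\<^sup>2) - (LINT x:A|N. (\<sigma> x)\<^sup>2))
     - (LBINT x:A. r * w x)"

text \<open>\<open>(p, n)\<close> is the Jordan decomposition of the signed Radon measure \<open>\<kappa>\<close> on \<open>I\<close>.\<close>

definition jordan_decomposition ::
    "real set \<Rightarrow> (real set \<Rightarrow> real) \<Rightarrow> real measure \<Rightarrow> real measure \<Rightarrow> bool" where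
  "jordan_decomposition I \<kappa> p n \<longleftrightarrow> radon_on I p \<and> radon_on I n \<and>
     (\<exists>S\<in>sets borel. S \<subseteq> I \<and> emeasure p (I - S) = 0 \<and> emeasure n S = 0) \<and>
     (\<forall>a\<in>I. \<forall>b\<in>I. \<forall>A\<in>sets borel. A \<subseteq> {a..b} \<longrightarrow> measure p A - measure n A = \<kappa> A)"

definition support_in :: "real set \<Rightarrow> real measure \<Rightarrow> real set" where
  "support_in I \<nu> = {x\<in>I. \<forall>U. open U \<and> x \<in> U \<longrightarrow> emeasure \<nu> (U \<inter> I) > 0}"

definition generator_condition ::
    "real set \<Rightarrow> (real \<Rightarrow> real) \<Rightarrow> (real \<Rightarrow> real) \<Rightarrow> real \<Rightarrow> (real \<Rightarrow> real) \<Rightarrow> bool" where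
  "generator_condition I \<mu> \<sigma> r w \<longleftrightarrow>
     (\<exists>P N p n. second_derivative_measure I w P N \<and>
        jordan_decomposition I (generator_measure \<mu> \<sigma> r w P N) p n \<and>
        separated_in I (top_of_set I frontier_of support_in I p) \<and>
        separated_in I (top_of_set I frontier_of support_in I n))"

text \<open>The conditions on \<open>f, g, h\<close> under the law of the process \<open>X\<close> on \<open>M\<close>.\<close>

definition integrability_condition ::
    "real \<Rightarrow> (real \<Rightarrow> real) \<Rightarrow> (real \<Rightarrow> real) \<Rightarrow> (real \<Rightarrow> real) \<Rightarrow>
     'w measure \<Rightarrow> (real \<Rightarrow> 'w \<Rightarrow> real) \<Rightarrow> bool" where
  "integrability_condition r f g h M X \<longleftrightarrow>
     (\<forall>w\<in>{f, g, h}. AE \<omega> in M. ((\<lambda>t. exp (- r * t) * w (X t \<omega>)) \<longlongrightarrow> 0) at_top) \<and>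
     (\<integral>\<^sup>+\<omega>. (SUP t\<in>{0..}. ennreal (exp (- r * t) * \<bar>f (X t \<omega>)\<bar>))
         + (SUP t\<in>{0..}. ennreal (exp (- r * t) * \<bar>g (X t \<omega>)\<bar>))
         + (SUP t\<in>{0..}. ennreal (exp (- r * t) * \<bar>h (X t \<omega>)\<bar>)) \<partial>M) < \<infinity>"


section \<open>The game\<close>

text \<open>
  \<open>E\<^sub>1, E\<^sub>2\<close> are standard exponential, and \<open>E\<^sub>1\<close>, \<open>E\<^sub>2\<close> and the filtration \<open>F\<close> (which carries
  \<open>X\<close> and \<open>W\<close>) are mutually independent.
\<close>

definition randomization_devices ::
    "'w measure \<Rightarrow> (real \<Rightarrow> 'w measure) \<Rightarrow> ('w \<Rightarrow> real) \<Rightarrow> ('w \<Rightarrow> real) \<Rightarrow> bool" where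
  "randomization_devices M F E\<^sub>1 E\<^sub>2 \<longleftrightarrow>
     distributed M lborel E\<^sub>1 (exponential_density 1) \<and>
     distributed M lborel E\<^sub>2 (exponential_density 1) \<and>
     prob_space.indep_sets M
       (\<lambda>i::nat. if i = 0 then sigma_sets (space M) (\<Union>t\<in>{0..}. sets (F t))
                 else if i = 1 then {E\<^sub>1 -` B \<inter> space M | B. B \<in> sets borel}
                 else {E\<^sub>2 -` B \<inter> space M | B. B \<in> sets borel})
       {0, 1, 2}"

text \<open>
  The convention \<open>\<Psi>\<^sub>0\<^sub>- = 0\<close> imposes nothing on \<open>(\<Psi>\<^sub>t)\<^sub>t\<^sub>\<ge>\<^sub>0\<close>: a jump at time \<open>0\<close> is allowed.
\<close>

definition admissible ::
    "'w measure \<Rightarrow> (real \<Rightarrow> 'w \<Rightarrow> real) \<Rightarrow> ('w \<Rightarrow> real) \<Rightarrow> ('w \<Rightarrow> ennreal) set" where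
  "admissible M X E =
     {\<tau>. \<exists>\<Psi> :: real \<Rightarrow> 'w \<Rightarrow> ennreal.
        (\<forall>\<omega>\<in>space M. mono_on {0..} (\<lambda>t. \<Psi> t \<omega>)) \<and>
        (\<forall>\<omega>\<in>space M. \<forall>t\<ge>0. continuous (at_right t) (\<lambda>s. \<Psi> s \<omega>)) \<and>
        adapted (augmented_filtration M X) \<Psi> \<and>
        \<tau> = (\<lambda>\<omega>. INF t\<in>{t. 0 \<le> t \<and> \<Psi> t \<omega> \<ge> ennreal (E \<omega>)}. ennreal t)}"

definition discounted ::
    "real \<Rightarrow> (real \<Rightarrow> real) \<Rightarrow> (real \<Rightarrow> 'w \<Rightarrow> real) \<Rightarrow> ('w \<Rightarrow> ennreal) \<Rightarrow> 'w \<Rightarrow> real" where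
  "discounted r w X \<tau> \<omega> =
     (if \<tau> \<omega> = \<infinity> then 0 else exp (- r * enn2real (\<tau> \<omega>)) * w (X (enn2real (\<tau> \<omega>)) \<omega>))"

definition payoff ::
    "real \<Rightarrow> (real \<Rightarrow> real) \<Rightarrow> (real \<Rightarrow> real) \<Rightarrow> (real \<Rightarrow> real) \<Rightarrow> 'w measure \<Rightarrow>
     (real \<Rightarrow> 'w \<Rightarrow> real) \<Rightarrow> ('w \<Rightarrow> ennreal) \<Rightarrow> ('w \<Rightarrow> ennreal) \<Rightarrow> real" where
  "payoff r f g h M X \<tau>\<^sub>1 \<tau>\<^sub>2 =
     (LINT \<omega>|M. (if \<tau>\<^sub>1 \<omega> < \<tau>\<^sub>2 \<omega> then discounted r f X \<tau>\<^sub>1 \<omega>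
                else if \<tau>\<^sub>1 \<omega> > \<tau>\<^sub>2 \<omega> then discounted r g X \<tau>\<^sub>2 \<omega>
                else discounted r h X \<tau>\<^sub>1 \<omega>))"

text \<open>Since the process is given as a family over its starting points, so are strategies.\<close>

definition markovian_pure ::
    "real set \<Rightarrow> (real \<Rightarrow> real \<Rightarrow> 'w \<Rightarrow> real) \<Rightarrow> (real \<Rightarrow> 'w \<Rightarrow> ennreal) \<Rightarrow> bool" where
  "markovian_pure I X \<tau> \<longleftrightarrow> (\<exists>D\<in>sets borel. D \<subseteq> I \<and> \<tau> = (\<lambda>x. first_entry (X x) D))"

definition global_markovian_pure_nash ::
    "real set \<Rightarrow> real \<Rightarrow> (real \<Rightarrow> real) \<Rightarrow> (real \<Rightarrow> real) \<Rightarrow> (real \<Rightarrow> real) \<Rightarrow>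
     (real \<Rightarrow> 'w measure) \<Rightarrow> (real \<Rightarrow> real \<Rightarrow> 'w \<Rightarrow> real) \<Rightarrow> (real \<Rightarrow> 'w \<Rightarrow> real) \<Rightarrow>
     (real \<Rightarrow> 'w \<Rightarrow> real) \<Rightarrow> (real \<Rightarrow> 'w \<Rightarrow> ennreal) \<Rightarrow> (real \<Rightarrow> 'w \<Rightarrow> ennreal) \<Rightarrow> bool" where
  "global_markovian_pure_nash I r f g h M X E\<^sub>1 E\<^sub>2 \<tau>\<^sub>1 \<tau>\<^sub>2 \<longleftrightarrow>
     markovian_pure I X \<tau>\<^sub>1 \<and> markovian_pure I X \<tau>\<^sub>2 \<and>
     (\<forall>x\<in>I.
        (\<forall>\<tau>\<in>admissible (M x) (X x) (E\<^sub>1 x).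
           payoff r f g h (M x) (X x) \<tau> (\<tau>\<^sub>2 x) \<le> payoff r f g h (M x) (X x) (\<tau>\<^sub>1 x) (\<tau>\<^sub>2 x)) \<and>
        (\<forall>\<tau>\<in>admissible (M x) (X x) (E\<^sub>2 x).
           payoff r f g h (M x) (X x) (\<tau>\<^sub>1 x) (\<tau>\<^sub>2 x) \<le> payoff r f g h (M x) (X x) (\<tau>\<^sub>1 x) \<tau>))"

definition admissible_before ::
    "'w measure \<Rightarrow> (real \<Rightarrow> 'w \<Rightarrow> real) \<Rightarrow> ('w \<Rightarrow> real) \<Rightarrow> real set \<Rightarrow> ('w \<Rightarrow> ennreal) set" where
  "admissible_before M X E D =
     {\<tau> \<in> admissible M X E. AE \<omega> in M. \<tau> \<omega> < first_entry X D \<omega>}"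

end

theory Submission
  imports Defs
begin

text \<open>
  Write \<open>V x\<close> for the value of a hypothetical equilibrium started at \<open>x\<close>, in which Player 1 stops on
  entering \<open>D\<^sub>1\<close> and Player 2 on entering \<open>D\<^sub>2\<close>.  Everything rests on one bound, \<open>V x \<le> max (f x) (g x)\<close>
  (\<open>equilibrium_value_le\<close>).  To see it, let Player 2 stop at the deterministic time \<open>1 / (n + 1)\<close>.
  On paths where Player 1 stops at time \<open>0\<close> Player 2 is too late and pays \<open>f x\<close>; on all other paths
  Player 2 is eventually the first to stop, and by continuity of the paths pays nearly \<open>g x\<close>.  By
  dominated convergence the payoffs tend to a mixture of \<open>f x\<close> and \<open>g x\<close>, the weight of \<open>f x\<close> being
  the probability that Player 1 stops at once.  Simultaneous stopping, and with it the payoff \<open>h\<close>,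
  disappears in the limit.

  The bound yields the contradiction in two steps (\<open>no_entry_equilibrium\<close>).  Let \<open>U\<close> be the region
  where \<open>max f g < h\<close>.  If \<open>D\<^sub>2\<close> contained a point \<open>x\<close> of \<open>U\<close>, then Player 1 could stop together with
  Player 2 at time \<open>0\<close> and secure \<open>h x > max (f x) (g x)\<close>.  Hence \<open>D\<^sub>2\<close> avoids \<open>U\<close>, and Player 2 does
  not stop before the exit from \<open>U\<close>.  But then the time \<open>\<tau>\<close> supplied by the first condition, which is
  smaller than the exit time, almost surely comes before Player 2 stops, so Player 1 secures the
  expectation of the discounted \<open>f\<close> at \<open>\<tau>\<close>, which exceeds \<open>max (f x\<^sub>0) (g x\<^sub>0)\<close>.
  The second condition is the first one for the game in
  which the players change places and all payoffs change sign (\<open>payoff_swap\<close>).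

  The dominated convergence step integrates a reward evaluated at the entry time of \<open>D\<^sub>1\<close>, so this
  time has to be measurable (\<open>first_entry_measurable\<close>).  On the line this is elementary: a path that
  starts at \<open>x\<close> and reaches \<open>d\<close> crosses every point in between, and some countable subset of
  \<open>D\<^sub>1\<close> meets every segment from \<open>x\<close> to a point of \<open>D\<^sub>1\<close>.
\<close>

section \<open>Approximating times by rational grids\<close>

text \<open>The largest multiple of \<open>1 / (m + 1)\<close> not exceeding \<open>t\<close>, for \<open>t \<ge> 0\<close>.  Rounding down keeps the
  approximating times inside any interval \<open>{0..T}\<close> that contains \<open>t\<close>.\<close>

definition grid :: "nat \<Rightarrow> real \<Rightarrow> real" where
  "grid m t = real (nat \<lfloor>real (Suc m) * t\<rfloor>) / real (Suc m)"

lemma grid_nonneg: "0 \<le> grid m t"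
  by (simp add: grid_def)

lemma grid_le: "grid m t \<le> t" if "0 \<le> t"
proof -
  have "real (nat \<lfloor>real (Suc m) * t\<rfloor>) \<le> real (Suc m) * t"
    using that by (intro of_nat_floor) simp
  then show ?thesis
    by (simp add: grid_def field_simps)
qed

lemma grid_ge: "t - 1 / real (Suc m) \<le> grid m t"
proof -
  have "real (Suc m) * t \<le> real (nat \<lfloor>real (Suc m) * t\<rfloor>) + 1"
    by linarith
  then have "(real (Suc m) * t - 1) / real (Suc m) \<le> grid m t"
    unfolding grid_def by (intro divide_right_mono) auto
  then show ?thesis
    by (simp add: diff_divide_distrib)
qed

lemma grid_tendsto: "(\<lambda>m. grid m t) \<longlonglongrightarrow> t" if "0 \<le> t"
proof (rule tendsto_sandwich)
  show "(\<lambda>m. t - 1 / real (Suc m)) \<longlonglongrightarrow> t"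
    using tendsto_diff[OF tendsto_const LIMSEQ_inverse_real_of_nat, of t] by (simp add: inverse_eq_divide)
qed (use grid_ge grid_le[OF that] in auto)

lemma tendsto_grid:
  fixes Z :: "real \<Rightarrow> 'a::topological_space"
  assumes "continuous_on {0..} Z" and "0 \<le> t"
  shows "(\<lambda>m. Z (grid m t)) \<longlonglongrightarrow> Z t"
  by (rule continuous_on_tendsto_compose[OF assms(1) grid_tendsto]) (use assms grid_nonneg in auto)

section \<open>Entry times of subsets of the line\<close>

text \<open>If \<open>d\<close> is not the greatest element of \<open>S\<close>, the open half-line above \<open>d\<close> meets \<open>S\<close> and hence any
  dense subset of \<open>S\<close>.  A greatest element, if there is one, is added to the dense subset.\<close>

lemma countable_cofinal_above:
  fixes S :: "real set"
  obtains C where "countable C" "C \<subseteq> S" "\<And>d. d \<in> S \<Longrightarrow> \<exists>c\<in>C. d \<le> c"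
proof -
  obtain T where T: "countable T" "T \<subseteq> S" "S \<subseteq> closure T"
    by (rule separable)
  define C where "C = T \<union> {d\<in>S. \<forall>e\<in>S. e \<le> d}"
  have max: "{d\<in>S. \<forall>e\<in>S. e \<le> d} \<subseteq> {Sup S}"
    by (auto intro!: cSup_eq_maximum[symmetric])
  have "countable C"
    using T(1) countable_subset[OF max] by (simp add: C_def)
  moreover have "C \<subseteq> S"
    using T by (auto simp: C_def)
  moreover have "\<exists>c\<in>C. d \<le> c" if d: "d \<in> S" for d
  proof (cases "\<forall>e\<in>S. e \<le> d")
    case False
    then obtain e where e: "e \<in> S" "d < e" by auto
    then have "{d<..} \<inter> T \<noteq> {}"
      using T(3) open_Int_closure_eq_empty[of "{d<..}" T] by auto
    then show ?thesis
      by (auto simp: C_def intro: less_imp_le)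
  qed (use d in \<open>auto simp: C_def\<close>)
  ultimately show ?thesis using that by blast
qed

text \<open>A countable subset of \<open>D\<close> that screens \<open>D\<close> from \<open>x\<close>: nothing that moves continuously from \<open>x\<close>
  reaches \<open>D\<close> without touching the screen.  On each side of \<open>x\<close> it consists of points of \<open>D\<close> that get as close to \<open>x\<close> as points of \<open>D\<close> on this
  side do.\<close>

lemma countable_screen:
  fixes D :: "real set" and x :: real
  obtains C where "countable C" "C \<subseteq> D"
    "\<And>d. d \<in> D \<Longrightarrow> \<exists>c\<in>C. c \<in> closed_segment x d"
proof -
  obtain A where A: "countable A" "A \<subseteq> D \<inter> {..x}" "\<And>d. d \<in> D \<inter> {..x} \<Longrightarrow> \<exists>c\<in>A. d \<le> c"
    by (rule countable_cofinal_above[of "D \<inter> {..x}"]) blast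
  obtain B where B: "countable B" "B \<subseteq> uminus ` (D \<inter> {x..})"
    "\<And>d. d \<in> uminus ` (D \<inter> {x..}) \<Longrightarrow> \<exists>c\<in>B. d \<le> c"
    by (rule countable_cofinal_above[of "uminus ` (D \<inter> {x..})"]) blast
  have *: "\<exists>c\<in>A \<union> uminus ` B. c \<in> closed_segment x d" if d: "d \<in> D" for d
  proof (cases "d \<le> x")
    case True
    then obtain c where "c \<in> A" "d \<le> c" using A(3)[of d] d by auto
    then show ?thesis using A(2) True
      by (intro bexI[of _ c]) (auto simp: closed_segment_eq_real_ivl)
  next
    case False
    then obtain c where c: "c \<in> B" "- d \<le> c" using B(3)[of "- d"] d by auto
    then have "- c \<ge> x" using B(2) by auto
    then show ?thesis using c False
      by (intro bexI[of _ "- c"]) (auto simp: closed_segment_eq_real_ivl)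
  qed
  have sub: "A \<union> uminus ` B \<subseteq> D"
  proof -
    have "uminus ` B \<subseteq> uminus ` uminus ` (D \<inter> {x..})"
      using B(2) by (rule image_mono)
    then show ?thesis using A(2) by (auto simp: image_image)
  qed
  have "countable (A \<union> uminus ` B)"
    using A(1) B(1) by simp
  from this sub * show ?thesis by (rule that)
qed

lemma first_entry_antimono: "A \<subseteq> B \<Longrightarrow> first_entry X B \<omega> \<le> first_entry X A \<omega>"
  unfolding first_entry_def by (rule INF_superset_mono) auto

lemma first_entry_le: "0 \<le> t \<Longrightarrow> X t \<omega> \<in> B \<Longrightarrow> first_entry X B \<omega> \<le> ennreal t"
  unfolding first_entry_def by (rule INF_lower) auto

text \<open>Whenever the path is in \<open>D\<close>, the intermediate value theorem shows that it has already met the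
  screen, then or earlier.\<close>

lemma first_entry_eq_INF_screen:
  assumes cont: "continuous_on {0..} (\<lambda>t. X t \<omega>)" and start: "X 0 \<omega> = x" and "C \<subseteq> D"
    and screen: "\<And>d. d \<in> D \<Longrightarrow> \<exists>c\<in>C. c \<in> closed_segment x d"
  shows "first_entry X D \<omega> = (INF c\<in>C. first_entry X {c} \<omega>)"
proof (rule antisym)
  show "first_entry X D \<omega> \<le> (INF c\<in>C. first_entry X {c} \<omega>)"
    using \<open>C \<subseteq> D\<close> by (intro INF_greatest first_entry_antimono) auto
  show "(INF c\<in>C. first_entry X {c} \<omega>) \<le> first_entry X D \<omega>"
    unfolding first_entry_def[of X D]
  proof (rule INF_greatest)
    fix t assume t: "t \<in> {t. 0 \<le> t \<and> X t \<omega> \<in> D}"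
    then obtain c where c: "c \<in> C" "c \<in> closed_segment x (X t \<omega>)"
      using screen by auto
    have "\<exists>s\<in>closed_segment 0 t. X s \<omega> = c"
    proof (rule IVT'_closed_segment_real)
      show "c \<in> closed_segment (X 0 \<omega>) (X t \<omega>)"
        using c start by simp
      show "continuous_on (closed_segment 0 t) (\<lambda>s. X s \<omega>)"
        using t by (intro continuous_on_subset[OF cont]) (auto simp: closed_segment_eq_real_ivl)
    qed
    then obtain s where s: "0 \<le> s" "s \<le> t" "X s \<omega> = c"
      using t by (auto simp: closed_segment_eq_real_ivl)
    have "(INF c\<in>C. first_entry X {c} \<omega>) \<le> first_entry X {c} \<omega>"
      using c by (intro INF_lower)
    also have "\<dots> \<le> ennreal s"
      using s by (intro first_entry_le) auto
    also have "\<dots> \<le> ennreal t"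
      using s by (intro ennreal_leI)
    finally show "(INF c\<in>C. first_entry X {c} \<omega>) \<le> ennreal t" .
  qed
qed

section \<open>The game with the players exchanged\<close>

lemma discounted_uminus: "discounted r (\<lambda>y. - w y) X \<tau> \<omega> = - discounted r w X \<tau> \<omega>"
  by (simp add: discounted_def)

lemma integrability_condition_uminus:
  assumes "integrability_condition r f g h M X"
  shows "integrability_condition r (\<lambda>y. - g y) (\<lambda>y. - f y) (\<lambda>y. - h y) M X"
proof -
  have "AE \<omega> in M. ((\<lambda>t. exp (- r * t) * - w (X t \<omega>)) \<longlongrightarrow> 0) at_top"
    if "AE \<omega> in M. ((\<lambda>t. exp (- r * t) * w (X t \<omega>)) \<longlongrightarrow> 0) at_top" for w
    using that by eventually_elim (auto dest: tendsto_minus)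
  then show ?thesis
    using assms by (simp add: integrability_condition_def ac_simps)
qed

lemma payoff_swap:
  "payoff r f g h M X \<tau>\<^sub>1 \<tau>\<^sub>2 = - payoff r (\<lambda>y. - g y) (\<lambda>y. - f y) (\<lambda>y. - h y) M X \<tau>\<^sub>2 \<tau>\<^sub>1"
proof -
  have "(if \<tau>\<^sub>1 \<omega> < \<tau>\<^sub>2 \<omega> then discounted r f X \<tau>\<^sub>1 \<omega>
            else if \<tau>\<^sub>1 \<omega> > \<tau>\<^sub>2 \<omega> then discounted r g X \<tau>\<^sub>2 \<omega> else discounted r h X \<tau>\<^sub>1 \<omega>) =
     - (if \<tau>\<^sub>2 \<omega> < \<tau>\<^sub>1 \<omega> then discounted r (\<lambda>y. - g y) X \<tau>\<^sub>2 \<omega>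
            else if \<tau>\<^sub>2 \<omega> > \<tau>\<^sub>1 \<omega> then discounted r (\<lambda>y. - f y) X \<tau>\<^sub>1 \<omega>
            else discounted r (\<lambda>y. - h y) X \<tau>\<^sub>2 \<omega>)" for \<omega>
    unfolding discounted_uminus by (auto simp: discounted_def)
  then show ?thesis
    by (simp add: payoff_def)
qed

section \<open>Deviations to deterministic times\<close>

text \<open>The hazard process jumps from \<open>0\<close> to \<open>\<infinity>\<close> at time \<open>c\<close>.  It reaches the level \<open>E\<close> exactly then
  provided that \<open>E\<close> is positive; a level \<open>E \<le> 0\<close> would be reached at time \<open>0\<close>.\<close>

lemma deterministic_time_admissible:
  assumes "0 \<le> c"
  obtains \<tau> where "\<tau> \<in> admissible M X E" "\<And>\<omega>. E \<omega> > 0 \<Longrightarrow> \<tau> \<omega> = ennreal c"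
proof
  let ?\<Psi> = "\<lambda>t \<omega>. if c \<le> t then \<infinity> else 0 :: ennreal"
  let ?\<tau> = "\<lambda>\<omega>. INF t\<in>{t. 0 \<le> t \<and> ?\<Psi> t \<omega> \<ge> ennreal (E \<omega>)}. ennreal t"
  have "continuous (at_right t) (\<lambda>s. ?\<Psi> s \<omega>)" for t \<omega>
  proof -
    have "eventually (\<lambda>s. ?\<Psi> s \<omega> = ?\<Psi> t \<omega>) (at_right t)"
    proof (cases "c \<le> t")
      case True
      then show ?thesis by (auto simp: eventually_at_filter intro!: always_eventually)
    next
      case False
      then show ?thesis by (auto simp: eventually_at_right_field intro!: exI[of _ c])
    qed
    then have "((\<lambda>s. ?\<Psi> s \<omega>) \<longlongrightarrow> ?\<Psi> t \<omega>) (at_right t)"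
      by (rule tendsto_eventually)
    then show ?thesis
      by (cases "c \<le> t") (simp_all add: continuous_within)
  qed
  then show "?\<tau> \<in> admissible M X E"
    unfolding admissible_def adapted_def
    by (intro CollectI exI[of _ ?\<Psi>]) (auto simp: mono_on_def)
  show "?\<tau> \<omega> = ennreal c" if "E \<omega> > 0" for \<omega>
  proof (rule antisym)
    show "?\<tau> \<omega> \<le> ennreal c"
      by (rule INF_lower) (use assms in auto)
    show "ennreal c \<le> ?\<tau> \<omega>"
      by (rule INF_greatest) (use that in \<open>auto intro!: ennreal_leI split: if_splits\<close>)
  qed
qed

section \<open>Almost sure modifications on complete spaces\<close>

context complete_measure
begin

lemma measurable_cong_AE_complete:
  assumes f: "f \<in> measurable M N" and eq: "AE x in M. f x = f' x"
    and space: "\<And>x. x \<in> space M \<Longrightarrow> f' x \<in> space N"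
  shows "f' \<in> measurable M N"
proof (rule measurableI[OF space])
  fix A assume "A \<in> sets N"
  with f have preimage: "f -` A \<inter> space M \<in> sets M" by (rule measurable_sets)
  have "AE x in M. x \<in> f -` A \<inter> space M \<longleftrightarrow> x \<in> f' -` A \<inter> space M"
    using eq by eventually_elim auto
  from this preimage show "f' -` A \<inter> space M \<in> sets M"
    by (rule in_sets_AE) simp
qed

text \<open>On a complete space, functions that agree almost everywhere are either both measurable, or both
  have the default integral \<open>0\<close>.  Therefore any stopping time, measurable or not, may be altered on a
  null set inside a payoff.\<close>

lemma integral_cong_AE_complete:
  fixes f f' :: "'a \<Rightarrow> real"
  assumes "AE x in M. f x = f' x"
  shows "(LINT x|M. f x) = (LINT x|M. f' x)"
proof (cases "f \<in> borel_measurable M")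
  case True
  then show ?thesis
    using measurable_cong_AE_complete[OF True assms] assms by (intro integral_cong_AE) auto
next
  case False
  have "AE x in M. f' x = f x"
    using assms by eventually_elim simp
  then have "f' \<notin> borel_measurable M"
    using False measurable_cong_AE_complete[of f' borel f] by auto
  with False have "\<not> integrable M f" "\<not> integrable M f'"
    by auto
  then show ?thesis
    by (simp add: not_integrable_integral_eq)
qed

lemma payoff_cong_AE:
  assumes "AE \<omega> in M. \<tau>\<^sub>1 \<omega> = \<tau>\<^sub>1' \<omega>" and "AE \<omega> in M. \<tau>\<^sub>2 \<omega> = \<tau>\<^sub>2' \<omega>"
  shows "payoff r f g h M X \<tau>\<^sub>1 \<tau>\<^sub>2 = payoff r f g h M X \<tau>\<^sub>1' \<tau>\<^sub>2'"
  unfolding payoff_def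
proof (rule integral_cong_AE_complete)
  show "AE \<omega> in M.
    (if \<tau>\<^sub>1 \<omega> < \<tau>\<^sub>2 \<omega> then discounted r f X \<tau>\<^sub>1 \<omega>
     else if \<tau>\<^sub>1 \<omega> > \<tau>\<^sub>2 \<omega> then discounted r g X \<tau>\<^sub>2 \<omega> else discounted r h X \<tau>\<^sub>1 \<omega>) =
    (if \<tau>\<^sub>1' \<omega> < \<tau>\<^sub>2' \<omega> then discounted r f X \<tau>\<^sub>1' \<omega>
     else if \<tau>\<^sub>1' \<omega> > \<tau>\<^sub>2' \<omega> then discounted r g X \<tau>\<^sub>2' \<omega> else discounted r h X \<tau>\<^sub>1' \<omega>)"
    using assms by eventually_elim (simp only: discounted_def)
qed

end

section \<open>Measurability of stopped rewards\<close>

locale started_process = prob_space M + complete_measure M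
  for M :: "'w measure" and X :: "real \<Rightarrow> 'w \<Rightarrow> real" and I :: "real set" and x :: real +
  assumes X_measurable: "0 \<le> t \<Longrightarrow> X t \<in> borel_measurable M"
    and X_continuous: "\<omega> \<in> space M \<Longrightarrow> continuous_on {0..} (\<lambda>t. X t \<omega>)"
    and X_in: "\<omega> \<in> space M \<Longrightarrow> 0 \<le> t \<Longrightarrow> X t \<omega> \<in> I"
    and X_start: "AE \<omega> in M. X 0 \<omega> = x"
begin

text \<open>By compactness of \<open>{0..T}\<close>, a continuous path visits \<open>c\<close> as soon as it comes arbitrarily close
  to \<open>c\<close>, and for this it is enough to look at rational times.\<close>

lemma hits_point_measurable:
  assumes "0 \<le> T"
  shows "{\<omega>\<in>space M. \<exists>s\<in>{0..T}. X s \<omega> = c} \<in> sets M"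
proof -
  let ?Q = "\<rat> \<inter> {0..T}"
  have hit: "(\<exists>s\<in>{0..T}. X s \<omega> = c) \<longleftrightarrow> (\<forall>n. \<exists>q\<in>?Q. \<bar>X q \<omega> - c\<bar> < 1 / real (Suc n))"
    if \<omega>: "\<omega> \<in> space M" for \<omega>
  proof
    assume "\<exists>s\<in>{0..T}. X s \<omega> = c"
    then obtain s where s: "0 \<le> s" "s \<le> T" "X s \<omega> = c" by auto
    show "\<forall>n. \<exists>q\<in>?Q. \<bar>X q \<omega> - c\<bar> < 1 / real (Suc n)"
    proof
      fix n
      have "(\<lambda>m. X (grid m s) \<omega>) \<longlonglongrightarrow> c"
        using tendsto_grid[OF X_continuous[OF \<omega>] s(1)] s(3) by simp
      from LIMSEQ_D[OF this, of "1 / real (Suc n)"]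
      obtain m where "\<bar>X (grid m s) \<omega> - c\<bar> < 1 / real (Suc n)"
        by auto
      moreover have "grid m s \<in> ?Q"
        using grid_le[OF s(1), of m] s(2) grid_nonneg[of m s] by (auto simp: grid_def)
      ultimately show "\<exists>q\<in>?Q. \<bar>X q \<omega> - c\<bar> < 1 / real (Suc n)" by blast
    qed
  next
    assume close: "\<forall>n. \<exists>q\<in>?Q. \<bar>X q \<omega> - c\<bar> < 1 / real (Suc n)"
    have "continuous_on {0..T} (\<lambda>s. \<bar>X s \<omega> - c\<bar>)"
      by (intro continuous_intros continuous_on_subset[OF X_continuous[OF \<omega>]]) auto
    then obtain s where s: "s \<in> {0..T}" "\<And>q. q \<in> {0..T} \<Longrightarrow> \<bar>X s \<omega> - c\<bar> \<le> \<bar>X q \<omega> - c\<bar>"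
      using continuous_attains_inf[of "{0..T}" "\<lambda>s. \<bar>X s \<omega> - c\<bar>"] assms by auto
    have "X s \<omega> = c"
    proof (rule ccontr)
      assume "X s \<omega> \<noteq> c"
      then obtain n where "1 / real (Suc n) < \<bar>X s \<omega> - c\<bar>"
        using nat_approx_posE[of "\<bar>X s \<omega> - c\<bar>"] by auto
      moreover obtain q where "q \<in> ?Q" "\<bar>X q \<omega> - c\<bar> < 1 / real (Suc n)"
        using close by blast
      ultimately show False
        using s(2)[of q] by auto
    qed
    then show "\<exists>s\<in>{0..T}. X s \<omega> = c" using s by blast
  qed
  have "{\<omega>\<in>space M. \<exists>s\<in>{0..T}. X s \<omega> = c} =
      {\<omega>\<in>space M. \<forall>n. \<exists>q\<in>?Q. \<bar>X q \<omega> - c\<bar> < 1 / real (Suc n)}"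
    using hit by auto
  also have "\<dots> \<in> sets M"
  proof (intro sets.sets_Collect_countable_All sets.sets_Collect_countable_Ex')
    show "countable ?Q" by (simp add: countable_rat)
    show "{\<omega>\<in>space M. \<bar>X q \<omega> - c\<bar> < 1 / real (Suc n)} \<in> sets M" if "q \<in> ?Q" for q n
    proof -
      have [measurable]: "X q \<in> borel_measurable M" using that by (intro X_measurable) auto
      show ?thesis by measurable
    qed
  qed
  finally show ?thesis .
qed

lemma first_entry_point_measurable: "first_entry X {c} \<in> borel_measurable M"
proof (rule borel_measurableI_less)
  fix y :: ennreal
  let ?Q = "{q\<in>\<rat>. 0 \<le> q \<and> ennreal q < y}"
  have "first_entry X {c} \<omega> < y \<longleftrightarrow> (\<exists>q\<in>?Q. \<exists>s\<in>{0..q}. X s \<omega> = c)" for \<omega>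
  proof
    assume "first_entry X {c} \<omega> < y"
    then obtain s where s: "0 \<le> s" "X s \<omega> = c" "ennreal s < y"
      by (auto simp: first_entry_def INF_less_iff)
    have "\<exists>q\<in>\<rat>. s \<le> q \<and> ennreal q < y"
    proof (cases y)
      case (real u)
      with s have "s < u" by (simp add: ennreal_less_iff)
      then obtain q where "q \<in> \<rat>" "s < q" "q < u"
        using Rats_dense_in_real by blast
      then show ?thesis using s real by (auto simp: ennreal_less_iff intro!: bexI[of _ q])
    next
      case top
      obtain q where "q \<in> \<rat>" "s < q"
        using Rats_dense_in_real[of s "s + 1"] by auto
      then show ?thesis using top by (auto intro!: bexI[of _ q])
    qed
    then show "\<exists>q\<in>?Q. \<exists>s\<in>{0..q}. X s \<omega> = c"
      using s by fastforce
  next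
    assume "\<exists>q\<in>?Q. \<exists>s\<in>{0..q}. X s \<omega> = c"
    then obtain q s where qs: "ennreal q < y" "0 \<le> s" "s \<le> q" "X s \<omega> = c" by auto
    then have "first_entry X {c} \<omega> \<le> ennreal s" by (intro first_entry_le) auto
    also have "\<dots> \<le> ennreal q" using qs by (intro ennreal_leI)
    finally show "first_entry X {c} \<omega> < y" using qs(1) by order
  qed
  then have "{\<omega>\<in>space M. first_entry X {c} \<omega> < y} =
      {\<omega>\<in>space M. \<exists>q\<in>?Q. \<exists>s\<in>{0..q}. X s \<omega> = c}"
    by simp
  also have "\<dots> \<in> sets M"
    by (intro sets.sets_Collect_countable_Ex' hits_point_measurable)
       (auto intro: countable_subset[OF _ countable_rat])
  finally show "{\<omega>\<in>space M. first_entry X {c} \<omega> < y} \<in> sets M" .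
qed

text \<open>Screening replaces \<open>D\<close> by countably many points on all paths starting at \<open>x\<close>; the remaining paths
  form a null set, and the space is complete.\<close>

lemma first_entry_measurable: "first_entry X D \<in> borel_measurable M"
proof -
  obtain C where C: "countable C" "C \<subseteq> D" "\<And>d. d \<in> D \<Longrightarrow> \<exists>c\<in>C. c \<in> closed_segment x d"
    by (rule countable_screen[of D x]) blast
  have "(\<lambda>\<omega>. INF c\<in>C. first_entry X {c} \<omega>) \<in> borel_measurable M"
    using C(1) first_entry_point_measurable by (intro borel_measurable_INF)
  moreover have "AE \<omega> in M. (INF c\<in>C. first_entry X {c} \<omega>) = first_entry X D \<omega>"
    using X_start AE_space
  proof eventually_elim
    case (elim \<omega>)
    then show ?case
      using first_entry_eq_INF_screen[where X = X, OF X_continuous[OF elim(2)] elim(1) C(2,3)] by simp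
  qed
  ultimately show ?thesis
    by (rule measurable_cong_AE_complete) simp
qed

lemma reward_measurable:
  assumes "continuous_on I w" "0 \<le> t"
  shows "(\<lambda>\<omega>. w (X t \<omega>)) \<in> borel_measurable M"
proof -
  have "X t \<in> measurable M (restrict_space borel I)"
    using X_measurable X_in assms by (intro measurable_restrict_space2) auto
  then show ?thesis
    by (rule measurable_compose) (use assms in \<open>auto intro: borel_measurable_continuous_on_restrict\<close>)
qed

lemma reward_continuous:
  assumes "continuous_on I w" "\<omega> \<in> space M"
  shows "continuous_on {0..} (\<lambda>t. w (X t \<omega>))"
  by (rule continuous_on_compose2[OF assms(1) X_continuous]) (use assms X_in in auto)

text \<open>Rounded down to a grid, \<open>\<tau>\<close> takes countably many values, so that the reward at the rounded time
  is measurable; continuity of the paths permits passing to the limit.\<close>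

lemma discounted_measurable:
  assumes w: "continuous_on I w" and [measurable]: "\<tau> \<in> borel_measurable M"
  shows "discounted r w X \<tau> \<in> borel_measurable M"
proof -
  have [measurable]: "(\<lambda>\<omega>. w (X (enn2real (\<tau> \<omega>)) \<omega>)) \<in> borel_measurable M"
  proof (rule borel_measurable_LIMSEQ_real)
    show "(\<lambda>m. w (X (grid m (enn2real (\<tau> \<omega>))) \<omega>)) \<longlonglongrightarrow> w (X (enn2real (\<tau> \<omega>)) \<omega>)"
      if "\<omega> \<in> space M" for \<omega>
      by (rule tendsto_grid[OF reward_continuous[OF w that]]) simp
    show "(\<lambda>\<omega>. w (X (grid m (enn2real (\<tau> \<omega>))) \<omega>)) \<in> borel_measurable M" for m
      unfolding grid_def
      by (rule measurable_compose_countable[where f = "\<lambda>k \<omega>. w (X (real k / real (Suc m)) \<omega>)"])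
         (use w in \<open>auto intro!: reward_measurable\<close>)
  qed
  show ?thesis
    unfolding discounted_def[abs_def] by measurable
qed

text \<open>By continuity of the paths the supremum over all times equals the supremum over the rational ones.\<close>

lemma discounted_sup_measurable:
  assumes w: "continuous_on I w"
  shows "(\<lambda>\<omega>. SUP t\<in>{0..}. ennreal (exp (- r * t) * \<bar>w (X t \<omega>)\<bar>)) \<in> borel_measurable M"
proof -
  let ?Z = "\<lambda>t \<omega>. ennreal (exp (- r * t) * \<bar>w (X t \<omega>)\<bar>)"
  let ?Q = "\<rat> \<inter> {0..}"
  have "(SUP t\<in>{0..}. ?Z t \<omega>) = (SUP t\<in>?Q. ?Z t \<omega>)" if \<omega>: "\<omega> \<in> space M" for \<omega>
  proof (rule antisym)
    show "(SUP t\<in>{0..}. ?Z t \<omega>) \<le> (SUP t\<in>?Q. ?Z t \<omega>)"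
    proof (rule SUP_least)
      fix t :: real assume t: "t \<in> {0..}"
      have "continuous_on {0..} (\<lambda>t. ?Z t \<omega>)"
        by (intro continuous_on_ennreal continuous_intros reward_continuous[OF w \<omega>])
      then have lim: "(\<lambda>m. ?Z (grid m t) \<omega>) \<longlonglongrightarrow> ?Z t \<omega>"
        using t by (intro tendsto_grid) auto
      have upper: "?Z (grid m t) \<omega> \<le> (SUP t\<in>?Q. ?Z t \<omega>)" for m
        by (rule SUP_upper) (simp add: grid_def)
      show "?Z t \<omega> \<le> (SUP t\<in>?Q. ?Z t \<omega>)"
        by (rule LIMSEQ_le_const2[OF lim]) (use upper in blast)
    qed
  qed (rule SUP_subset_mono, auto)
  moreover have "(\<lambda>\<omega>. SUP t\<in>?Q. ?Z t \<omega>) \<in> borel_measurable M"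
  proof (rule borel_measurable_SUP)
    show "countable ?Q" by (simp add: countable_rat)
    show "?Z t \<in> borel_measurable M" if "t \<in> ?Q" for t
    proof -
      have [measurable]: "(\<lambda>\<omega>. w (X t \<omega>)) \<in> borel_measurable M"
        using that w by (intro reward_measurable) auto
      show ?thesis by measurable
    qed
  qed
  ultimately show ?thesis
    by (simp cong: measurable_cong)
qed

lemma discounted_le_sup:
  "ennreal \<bar>discounted r w X \<tau> \<omega>\<bar> \<le> (SUP t\<in>{0..}. ennreal (exp (- r * t) * \<bar>w (X t \<omega>)\<bar>))"
proof (cases "\<tau> \<omega> = \<infinity>")
  case False
  then have "ennreal \<bar>discounted r w X \<tau> \<omega>\<bar> =
      ennreal (exp (- r * enn2real (\<tau> \<omega>)) * \<bar>w (X (enn2real (\<tau> \<omega>)) \<omega>)\<bar>)"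
    by (simp add: discounted_def abs_mult)
  also have "\<dots> \<le> (SUP t\<in>{0..}. ennreal (exp (- r * t) * \<bar>w (X t \<omega>)\<bar>))"
    by (rule SUP_upper) auto
  finally show ?thesis .
qed (simp add: discounted_def)

section \<open>A bound on the equilibrium value\<close>

definition payoff_dominator :: "real \<Rightarrow> (real \<Rightarrow> real) \<Rightarrow> (real \<Rightarrow> real) \<Rightarrow> (real \<Rightarrow> real) \<Rightarrow> 'w \<Rightarrow> ennreal" where
  "payoff_dominator r f g h \<omega> =
     (SUP t\<in>{0..}. ennreal (exp (- r * t) * \<bar>f (X t \<omega>)\<bar>))
     + (SUP t\<in>{0..}. ennreal (exp (- r * t) * \<bar>g (X t \<omega>)\<bar>))
     + (SUP t\<in>{0..}. ennreal (exp (- r * t) * \<bar>h (X t \<omega>)\<bar>))"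

text \<open>For each path, \<open>\<tau> = 0\<close> precedes every time \<open>1 / (n + 1)\<close>, while \<open>\<tau> > 0\<close> comes after all but
  finitely many of them.  Hence the integrands converge pointwise, even if \<open>\<tau>\<close> has atoms
  at the times \<open>1 / (n + 1)\<close>.\<close>

lemma payoff_tendsto_stopping_soon:
  assumes cont: "continuous_on I f" "continuous_on I g" "continuous_on I h"
    and dom: "(\<integral>\<^sup>+\<omega>. payoff_dominator r f g h \<omega> \<partial>M) < \<infinity>"
    and \<tau>[measurable]: "\<tau> \<in> borel_measurable M"
  shows "(\<lambda>n. payoff r f g h M X \<tau> (\<lambda>_. ennreal (1 / real (Suc n))))
           \<longlonglongrightarrow> (LINT \<omega>|M. (if \<tau> \<omega> = 0 then f x else g x))"
proof -
  let ?S = "payoff_dominator r f g h"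
  let ?e = "\<lambda>n. 1 / real (Suc n)"
  let ?G = "\<lambda>n \<omega>. if \<tau> \<omega> < ennreal (?e n) then discounted r f X \<tau> \<omega>
                  else if \<tau> \<omega> > ennreal (?e n) then discounted r g X (\<lambda>_. ennreal (?e n)) \<omega>
                  else discounted r h X \<tau> \<omega>"
  have meas_S: "?S \<in> borel_measurable M"
    unfolding payoff_dominator_def[abs_def] using cont
    by (intro borel_measurable_add discounted_sup_measurable)
  have [measurable]: "discounted r f X \<tau> \<in> borel_measurable M" "discounted r h X \<tau> \<in> borel_measurable M"
    "discounted r g X (\<lambda>_. ennreal (?e n)) \<in> borel_measurable M" for n
    using cont by (auto intro!: discounted_measurable)
  have finite_S: "AE \<omega> in M. ?S \<omega> \<noteq> \<infinity>"
    using nn_integral_PInf_AE[OF meas_S] dom by simp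
  have bound: "ennreal \<bar>?G n \<omega>\<bar> \<le> ?S \<omega>" for n \<omega>
    using discounted_le_sup[of r f \<tau> \<omega>] discounted_le_sup[of r h \<tau> \<omega>]
      discounted_le_sup[of r g "\<lambda>_. ennreal (?e n)" \<omega>]
    unfolding payoff_dominator_def
    by (simp add: add_increasing add_increasing2)
  have "(\<lambda>n. LINT \<omega>|M. ?G n \<omega>) \<longlonglongrightarrow> (LINT \<omega>|M. (if \<tau> \<omega> = 0 then f x else g x))"
  proof (rule integral_dominated_convergence)
    show "?G n \<in> borel_measurable M" for n by measurable
    show "(\<lambda>\<omega>. if \<tau> \<omega> = 0 then f x else g x) \<in> borel_measurable M" by measurable
    show "integrable M (\<lambda>\<omega>. enn2real (?S \<omega>))"
    proof (rule integrableI_bounded)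
      show "(\<lambda>\<omega>. enn2real (?S \<omega>)) \<in> borel_measurable M" using meas_S by simp
      have "(\<integral>\<^sup>+\<omega>. ennreal (norm (enn2real (?S \<omega>))) \<partial>M) \<le> (\<integral>\<^sup>+\<omega>. ?S \<omega> \<partial>M)"
        by (intro nn_integral_mono) (simp add: ennreal_enn2real_if)
      then show "(\<integral>\<^sup>+\<omega>. ennreal (norm (enn2real (?S \<omega>))) \<partial>M) < \<infinity>"
        using dom by (rule le_less_trans)
    qed
    show "AE \<omega> in M. norm (?G n \<omega>) \<le> enn2real (?S \<omega>)" for n
      using finite_S
    proof eventually_elim
      case (elim \<omega>)
      have "\<bar>?G n \<omega>\<bar> = enn2real (ennreal \<bar>?G n \<omega>\<bar>)" by simp
      also have "\<dots> \<le> enn2real (?S \<omega>)"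
        using elim by (intro enn2real_mono bound) (simp add: top.not_eq_extremum)
      finally show ?case by simp
    qed
    show "AE \<omega> in M. (\<lambda>n. ?G n \<omega>) \<longlonglongrightarrow> (if \<tau> \<omega> = 0 then f x else g x)"
      using X_start AE_space
    proof eventually_elim
      case (elim \<omega>)
      show ?case
      proof (cases "\<tau> \<omega> = 0")
        case True
        then have "?G n \<omega> = f x" for n
          using elim by (simp add: discounted_def)
        then show ?thesis using True by simp
      next
        case False
        have e0: "?e \<longlonglongrightarrow> 0"
          using LIMSEQ_inverse_real_of_nat by (simp add: inverse_eq_divide)
        then have "(\<lambda>n. ennreal (?e n)) \<longlonglongrightarrow> ennreal 0"
          by (rule tendsto_ennrealI)
        then have "eventually (\<lambda>n. ennreal (?e n) < \<tau> \<omega>) sequentially"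
          using False by (intro order_tendstoD(2)) (auto simp: zero_less_iff_neq_zero)
        then have ev: "eventually (\<lambda>n. exp (- r * ?e n) * g (X (?e n) \<omega>) = ?G n \<omega>) sequentially"
          by eventually_elim (auto simp: discounted_def)
        have "continuous_on {0..} (\<lambda>t. exp (- r * t) * g (X t \<omega>))"
          using elim cont by (intro continuous_intros reward_continuous) auto
        from continuous_on_tendsto_compose[OF this e0]
        have "(\<lambda>n. exp (- r * ?e n) * g (X (?e n) \<omega>)) \<longlonglongrightarrow> g x"
          using elim by simp
        from Lim_transform_eventually[OF this ev] show ?thesis
          using False by simp
      qed
    qed
  qed
  then show ?thesis
    unfolding payoff_def .
qed

text \<open>\<open>V\<close> stands for the equilibrium value, which Player 2 cannot undercut by a deviation against \<open>\<tau>\<close>.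
  The times \<open>1 / (n + 1)\<close> are admissible deviations up to a null set, and their payoffs tend to an
  average of \<open>f x\<close> and \<open>g x\<close>.\<close>

lemma equilibrium_value_le:
  assumes cont: "continuous_on I f" "continuous_on I g" "continuous_on I h"
    and dom: "(\<integral>\<^sup>+\<omega>. payoff_dominator r f g h \<omega> \<partial>M) < \<infinity>"
    and \<tau>[measurable]: "\<tau> \<in> borel_measurable M"
    and E: "AE \<omega> in M. 0 < E \<omega>"
    and best: "\<And>\<tau>'. \<tau>' \<in> admissible M X E \<Longrightarrow> V \<le> payoff r f g h M X \<tau> \<tau>'"
  shows "V \<le> max (f x) (g x)"
proof -
  have "V \<le> payoff r f g h M X \<tau> (\<lambda>_. ennreal (1 / real (Suc n)))" for n
  proof -
    obtain \<tau>' where \<tau>': "\<tau>' \<in> admissible M X E"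
        "\<And>\<omega>. E \<omega> > 0 \<Longrightarrow> \<tau>' \<omega> = ennreal (1 / real (Suc n))"
      using deterministic_time_admissible[of "1 / real (Suc n)" M X E] by auto
    have "AE \<omega> in M. \<tau>' \<omega> = ennreal (1 / real (Suc n))"
      using E by eventually_elim (rule \<tau>'(2))
    then have "payoff r f g h M X \<tau> \<tau>' = payoff r f g h M X \<tau> (\<lambda>_. ennreal (1 / real (Suc n)))"
      by (intro payoff_cong_AE) auto
    with best[OF \<tau>'(1)] show ?thesis by simp
  qed
  then have "V \<le> (LINT \<omega>|M. (if \<tau> \<omega> = 0 then f x else g x))"
    by (intro LIMSEQ_le_const[OF payoff_tendsto_stopping_soon[OF cont dom \<tau>]]) auto
  also have "\<dots> \<le> max (f x) (g x)"
  proof (rule integral_le_const)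
    show "integrable M (\<lambda>\<omega>. if \<tau> \<omega> = 0 then f x else g x)"
      by (rule integrable_const_bound[of _ "max \<bar>f x\<bar> \<bar>g x\<bar>"]) auto
  qed auto
  finally show ?thesis .
qed

lemma payoff_stop_together:
  assumes "AE \<omega> in M. \<tau>\<^sub>1 \<omega> = 0" and "AE \<omega> in M. \<tau>\<^sub>2 \<omega> = 0"
  shows "payoff r f g h M X \<tau>\<^sub>1 \<tau>\<^sub>2 = h x"
proof -
  have "payoff r f g h M X \<tau>\<^sub>1 \<tau>\<^sub>2 = payoff r f g h M X (\<lambda>_. 0) (\<lambda>_. 0)"
    using assms by (rule payoff_cong_AE)
  also have "\<dots> = (LINT \<omega>|M. h x)"
    unfolding payoff_def
    by (rule integral_cong_AE_complete) (use X_start in \<open>eventually_elim, simp add: discounted_def\<close>)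
  finally show ?thesis by (simp add: prob_space)
qed

lemma payoff_stop_first:
  assumes "AE \<omega> in M. \<tau>\<^sub>1 \<omega> < \<tau>\<^sub>2 \<omega>"
  shows "payoff r f g h M X \<tau>\<^sub>1 \<tau>\<^sub>2 = (LINT \<omega>|M. discounted r f X \<tau>\<^sub>1 \<omega>)"
  unfolding payoff_def
  by (rule integral_cong_AE_complete) (use assms in \<open>eventually_elim, simp\<close>)

end

section \<open>Non-existence of equilibria\<close>

lemma (in prob_space) exponential_positive_AE:
  assumes "distributed M lborel E (exponential_density l)" "0 < l"
  shows "AE \<omega> in M. 0 < E \<omega>"
proof -
  have [measurable]: "E \<in> borel_measurable M"
    using distributed_measurable[OF assms(1)] by simp
  have "prob {\<omega>\<in>space M. 0 < E \<omega>} = 1"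
    using exponential_distributedD_gt[OF assms(1) order_refl assms(2)] by simp
  then show ?thesis
    by (subst (asm) prob_Collect_eq_1) measurable
qed

text \<open>Stated for Player 1's condition only; the other one is obtained by exchanging the players.\<close>

lemma no_entry_equilibrium:
  fixes M :: "real \<Rightarrow> 'w measure" and X :: "real \<Rightarrow> real \<Rightarrow> 'w \<Rightarrow> real"
    and r :: real and f g h :: "real \<Rightarrow> real" and D\<^sub>1 D\<^sub>2 :: "real set"
  defines "V \<equiv> \<lambda>x. payoff r f g h (M x) (X x) (first_entry (X x) D\<^sub>1) (first_entry (X x) D\<^sub>2)"
  assumes proc: "\<And>x. x \<in> I \<Longrightarrow> started_process (M x) (X x) I x"
    and cont: "continuous_on I f" "continuous_on I g" "continuous_on I h"
    and dom: "\<And>x. x \<in> I \<Longrightarrow> integrability_condition r f g h (M x) (X x)"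
    and E\<^sub>1: "\<And>x. x \<in> I \<Longrightarrow> AE \<omega> in M x. 0 < E\<^sub>1 x \<omega>"
    and E\<^sub>2: "\<And>x. x \<in> I \<Longrightarrow> AE \<omega> in M x. 0 < E\<^sub>2 x \<omega>"
    and D\<^sub>2: "D\<^sub>2 \<subseteq> I"
    and best\<^sub>1: "\<And>x \<tau>. x \<in> I \<Longrightarrow> \<tau> \<in> admissible (M x) (X x) (E\<^sub>1 x) \<Longrightarrow>
        payoff r f g h (M x) (X x) \<tau> (first_entry (X x) D\<^sub>2) \<le> V x"
    and best\<^sub>2: "\<And>x \<tau>. x \<in> I \<Longrightarrow> \<tau> \<in> admissible (M x) (X x) (E\<^sub>2 x) \<Longrightarrow>
        V x \<le> payoff r f g h (M x) (X x) (first_entry (X x) D\<^sub>1) \<tau>"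
    and x\<^sub>0: "x\<^sub>0 \<in> I"
    and sup: "ereal (max (f x\<^sub>0) (g x\<^sub>0)) <
        (SUP \<tau>\<in>admissible_before (M x\<^sub>0) (X x\<^sub>0) (E\<^sub>1 x\<^sub>0) (I - {y\<in>I. max (f y) (g y) < h y}).
           ereal (LINT \<omega>|M x\<^sub>0. discounted r f (X x\<^sub>0) \<tau> \<omega>))"
  shows False
proof -
  let ?U = "{y\<in>I. max (f y) (g y) < h y}"
  \<comment> \<open>Player 2 does not gain by stopping very soon.\<close>
  have cap: "V x \<le> max (f x) (g x)" if x: "x \<in> I" for x
  proof -
    interpret started_process "M x" "X x" I x using x by (rule proc)
    show ?thesis
      using dom[OF x] best\<^sub>2[OF x] E\<^sub>2[OF x] cont first_entry_measurable
      by (intro equilibrium_value_le[where \<tau> = "first_entry (X x) D\<^sub>1" and E = "E\<^sub>2 x" and h = h and r = r])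
         (auto simp: integrability_condition_def payoff_dominator_def)
  qed
  \<comment> \<open>Otherwise Player 1 would gain by stopping together with Player 2 at time \<open>0\<close>.\<close>
  have disj: "D\<^sub>2 \<subseteq> I - ?U"
  proof (rule ccontr)
    assume "\<not> D\<^sub>2 \<subseteq> I - ?U"
    then obtain x where x: "x \<in> I" "x \<in> D\<^sub>2" "max (f x) (g x) < h x"
      using D\<^sub>2 by blast
    interpret started_process "M x" "X x" I x using x(1) by (rule proc)
    have zero: "first_entry (X x) D\<^sub>2 \<omega> = 0" if "X x 0 \<omega> = x" for \<omega>
      using first_entry_le[of 0 "X x" \<omega> D\<^sub>2] that x by simp
    have entry: "AE \<omega> in M x. first_entry (X x) D\<^sub>2 \<omega> = 0"
      using X_start by eventually_elim (rule zero)
    obtain \<tau> where \<tau>: "\<tau> \<in> admissible (M x) (X x) (E\<^sub>1 x)"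
        and at_0: "\<And>\<omega>. E\<^sub>1 x \<omega> > 0 \<Longrightarrow> \<tau> \<omega> = ennreal 0"
      using deterministic_time_admissible[OF order_refl] by blast
    have now: "AE \<omega> in M x. \<tau> \<omega> = 0"
      using E\<^sub>1[OF x(1)] by eventually_elim (simp add: at_0)
    have "h x = payoff r f g h (M x) (X x) \<tau> (first_entry (X x) D\<^sub>2)"
      by (rule payoff_stop_together[symmetric, OF now entry])
    also have "\<dots> \<le> V x" by (rule best\<^sub>1[OF x(1) \<tau>])
    also have "\<dots> \<le> max (f x) (g x)" by (rule cap[OF x(1)])
    finally show False using x(3) by simp
  qed
  interpret started_process "M x\<^sub>0" "X x\<^sub>0" I x\<^sub>0 using x\<^sub>0 by (rule proc)
  obtain \<tau> where \<tau>: "\<tau> \<in> admissible_before (M x\<^sub>0) (X x\<^sub>0) (E\<^sub>1 x\<^sub>0) (I - ?U)"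
    and gain: "max (f x\<^sub>0) (g x\<^sub>0) < (LINT \<omega>|M x\<^sub>0. discounted r f (X x\<^sub>0) \<tau> \<omega>)"
    using sup by (auto simp: less_SUP_iff)
  have "AE \<omega> in M x\<^sub>0. \<tau> \<omega> < first_entry (X x\<^sub>0) (I - ?U) \<omega>"
    using \<tau> by (simp add: admissible_before_def)
  then have "AE \<omega> in M x\<^sub>0. \<tau> \<omega> < first_entry (X x\<^sub>0) D\<^sub>2 \<omega>"
    by eventually_elim (rule less_le_trans[OF _ first_entry_antimono[OF disj]])
  then have "payoff r f g h (M x\<^sub>0) (X x\<^sub>0) \<tau> (first_entry (X x\<^sub>0) D\<^sub>2) =
      (LINT \<omega>|M x\<^sub>0. discounted r f (X x\<^sub>0) \<tau> \<omega>)"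
    by (rule payoff_stop_first)
  moreover have "payoff r f g h (M x\<^sub>0) (X x\<^sub>0) \<tau> (first_entry (X x\<^sub>0) D\<^sub>2) \<le> V x\<^sub>0"
    using \<tau> by (intro best\<^sub>1 x\<^sub>0) (simp add: admissible_before_def)
  ultimately show False
    using gain cap[OF x\<^sub>0] by linarith
qed

lemma weak_solution_started_process:
  assumes "weak_solution I \<mu> \<sigma> x M F W X"
  shows "started_process M X I x"
proof -
  have sol: "prob_space M" "usual_filtration M F" "adapted F X" "continuous_paths M X"
    "\<forall>\<omega>\<in>space M. \<forall>t\<ge>0. X t \<omega> \<in> I" "AE \<omega> in M. X 0 \<omega> = x"
    using assms by (auto simp: weak_solution_def)
  interpret prob_space M by fact
  interpret complete_measure M using sol(2) by (simp add: usual_filtration_def)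
  show ?thesis
  proof
    show "X t \<in> borel_measurable M" if "0 \<le> t" for t
      using sol(2,3) that measurable_from_subalg[of M "F t" "X t" borel]
      by (auto simp: usual_filtration_def adapted_def)
  qed (use sol in \<open>auto simp: continuous_paths_def\<close>)
qed


theorem theorem14:
  fixes \<alpha> \<beta> :: ereal and I :: "real set" and r :: real
    and \<mu> \<sigma> f g h :: "real \<Rightarrow> real"
    and M :: "real \<Rightarrow> 'w measure" and F :: "real \<Rightarrow> real \<Rightarrow> 'w measure"
    and W X :: "real \<Rightarrow> real \<Rightarrow> 'w \<Rightarrow> real"
    and E\<^sub>1 E\<^sub>2 :: "real \<Rightarrow> 'w \<Rightarrow> real"
  assumes "\<alpha> < \<beta>" and "I = einterval \<alpha> \<beta>"
    and "continuous_on I \<mu>" and "continuous_on I \<sigma>" and "\<forall>x\<in>I. \<sigma> x > 0"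
    and "\<forall>x\<in>I. weak_solution I \<mu> \<sigma> x (M x) (F x) (W x) (X x)"
    and "unique_in_law TYPE('w) I \<mu> \<sigma>"
    and "regular_diffusion I M X"
    and "\<forall>x\<in>I. randomization_devices (M x) (F x) (E\<^sub>1 x) (E\<^sub>2 x)"
    and "r \<ge> 0"
    and "continuous_on I f" and "continuous_on I g" and "continuous_on I h"
    and "difference_of_convex I f" and "difference_of_convex I g" and "difference_of_convex I h"
    and "separated_in I (\<Union>B\<in>{B1 I f g h, B2 I f g h, B3 I f g h, B4 I f g h, B5 I f g h, B6 I f g h}.
           top_of_set I frontier_of B)"
    and "natural_left \<alpha> \<beta> \<mu> \<sigma>" and "natural_right \<alpha> \<beta> \<mu> \<sigma>"
    and "\<forall>x\<in>I. integrability_condition r f g h (M x) (X x)"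
    and "generator_condition I \<mu> \<sigma> r f" and "generator_condition I \<mu> \<sigma> r g"
    and "(\<exists>x\<^sub>0 \<in> B4 I f g h \<union> B5 I f g h.
            (SUP \<tau>\<in>admissible_before (M x\<^sub>0) (X x\<^sub>0) (E\<^sub>1 x\<^sub>0) (I - (B4 I f g h \<union> B5 I f g h)).
               ereal (LINT \<omega>|M x\<^sub>0. discounted r f (X x\<^sub>0) \<tau> \<omega>)) > ereal (max (f x\<^sub>0) (g x\<^sub>0)))
       \<or> (\<exists>x\<^sub>0 \<in> B3 I f g h \<union> B6 I f g h.
            (INF \<tau>\<in>admissible_before (M x\<^sub>0) (X x\<^sub>0) (E\<^sub>2 x\<^sub>0) (I - (B3 I f g h \<union> B6 I f g h)).
               ereal (LINT \<omega>|M x\<^sub>0. discounted r g (X x\<^sub>0) \<tau> \<omega>)) < ereal (min (f x\<^sub>0) (g x\<^sub>0)))"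
  shows "\<not> (\<exists>\<tau>\<^sub>1 \<tau>\<^sub>2. global_markovian_pure_nash I r f g h M X E\<^sub>1 E\<^sub>2 \<tau>\<^sub>1 \<tau>\<^sub>2)"
proof
  assume "\<exists>\<tau>\<^sub>1 \<tau>\<^sub>2. global_markovian_pure_nash I r f g h M X E\<^sub>1 E\<^sub>2 \<tau>\<^sub>1 \<tau>\<^sub>2"
  then obtain \<tau>\<^sub>1 \<tau>\<^sub>2 where nash: "global_markovian_pure_nash I r f g h M X E\<^sub>1 E\<^sub>2 \<tau>\<^sub>1 \<tau>\<^sub>2"
    by blast
  then obtain D\<^sub>1 D\<^sub>2 where D: "D\<^sub>1 \<subseteq> I" "D\<^sub>2 \<subseteq> I"
    and entry: "\<tau>\<^sub>1 = (\<lambda>x. first_entry (X x) D\<^sub>1)" "\<tau>\<^sub>2 = (\<lambda>x. first_entry (X x) D\<^sub>2)"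
    unfolding global_markovian_pure_nash_def markovian_pure_def by blast
  have best\<^sub>1: "payoff r f g h (M x) (X x) \<tau> (first_entry (X x) D\<^sub>2)
        \<le> payoff r f g h (M x) (X x) (first_entry (X x) D\<^sub>1) (first_entry (X x) D\<^sub>2)"
    if "x \<in> I" "\<tau> \<in> admissible (M x) (X x) (E\<^sub>1 x)" for x \<tau>
    using nash that unfolding global_markovian_pure_nash_def entry by blast
  have best\<^sub>2: "payoff r f g h (M x) (X x) (first_entry (X x) D\<^sub>1) (first_entry (X x) D\<^sub>2)
        \<le> payoff r f g h (M x) (X x) (first_entry (X x) D\<^sub>1) \<tau>"
    if "x \<in> I" "\<tau> \<in> admissible (M x) (X x) (E\<^sub>2 x)" for x \<tau>
    using nash that unfolding global_markovian_pure_nash_def entry by blast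
  have proc: "started_process (M x) (X x) I x" if "x \<in> I" for x
    using assms(6) that by (blast intro: weak_solution_started_process)
  have E: "AE \<omega> in M x. 0 < E\<^sub>1 x \<omega>" "AE \<omega> in M x. 0 < E\<^sub>2 x \<omega>" if "x \<in> I" for x
  proof -
    interpret started_process "M x" "X x" I x using that by (rule proc)
    show "AE \<omega> in M x. 0 < E\<^sub>1 x \<omega>" "AE \<omega> in M x. 0 < E\<^sub>2 x \<omega>"
      using assms(9) that by (auto intro!: exponential_positive_AE simp: randomization_devices_def)
  qed
  from assms(23) show False
  proof (elim disjE bexE)
    fix x\<^sub>0 assume "x\<^sub>0 \<in> B4 I f g h \<union> B5 I f g h"
      and sup: "(SUP \<tau>\<in>admissible_before (M x\<^sub>0) (X x\<^sub>0) (E\<^sub>1 x\<^sub>0) (I - (B4 I f g h \<union> B5 I f g h)).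
               ereal (LINT \<omega>|M x\<^sub>0. discounted r f (X x\<^sub>0) \<tau> \<omega>)) > ereal (max (f x\<^sub>0) (g x\<^sub>0))"
    then have "x\<^sub>0 \<in> I" by (simp add: B4_Un_B5)
    then show False
      using no_entry_equilibrium[where M = M and X = X and x\<^sub>0 = x\<^sub>0, OF proc assms(11-13) _ E D(2) best\<^sub>1 best\<^sub>2]
        assms(20) sup unfolding B4_Un_B5 by blast
  next
    fix x\<^sub>0 assume "x\<^sub>0 \<in> B3 I f g h \<union> B6 I f g h"
      and inf: "(INF \<tau>\<in>admissible_before (M x\<^sub>0) (X x\<^sub>0) (E\<^sub>2 x\<^sub>0) (I - (B3 I f g h \<union> B6 I f g h)).
               ereal (LINT \<omega>|M x\<^sub>0. discounted r g (X x\<^sub>0) \<tau> \<omega>)) < ereal (min (f x\<^sub>0) (g x\<^sub>0))"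
    then have x\<^sub>0: "x\<^sub>0 \<in> I" by (simp add: B3_Un_B6)
    let ?f = "\<lambda>y. - g y" and ?g = "\<lambda>y. - f y" and ?h = "\<lambda>y. - h y"
    have region: "B3 I f g h \<union> B6 I f g h = {y\<in>I. max (?f y) (?g y) < ?h y}"
      unfolding B3_Un_B6 by auto
    let ?T = "admissible_before (M x\<^sub>0) (X x\<^sub>0) (E\<^sub>2 x\<^sub>0) (I - {y\<in>I. max (?f y) (?g y) < ?h y})"
    show False
    proof (rule no_entry_equilibrium[where f = ?f and g = ?g and h = ?h and r = r and M = M and X = X
          and I = I and E\<^sub>1 = E\<^sub>2 and E\<^sub>2 = E\<^sub>1 and D\<^sub>1 = D\<^sub>2 and D\<^sub>2 = D\<^sub>1 and x\<^sub>0 = x\<^sub>0])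
      show "integrability_condition r ?f ?g ?h (M x) (X x)" if "x \<in> I" for x
        using assms(20) that by (auto simp: integrability_condition_uminus)
      show "payoff r ?f ?g ?h (M x) (X x) \<tau> (first_entry (X x) D\<^sub>1)
          \<le> payoff r ?f ?g ?h (M x) (X x) (first_entry (X x) D\<^sub>2) (first_entry (X x) D\<^sub>1)"
        if "x \<in> I" "\<tau> \<in> admissible (M x) (X x) (E\<^sub>2 x)" for x \<tau>
        using best\<^sub>2[OF that] by (simp add: payoff_swap[of r f g h])
      show "payoff r ?f ?g ?h (M x) (X x) (first_entry (X x) D\<^sub>2) (first_entry (X x) D\<^sub>1)
          \<le> payoff r ?f ?g ?h (M x) (X x) (first_entry (X x) D\<^sub>2) \<tau>"
        if "x \<in> I" "\<tau> \<in> admissible (M x) (X x) (E\<^sub>1 x)" for x \<tau>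
        using best\<^sub>1[OF that] by (simp add: payoff_swap[of r f g h])
      obtain \<tau> where \<tau>: "\<tau> \<in> ?T"
        and gain: "(LINT \<omega>|M x\<^sub>0. discounted r g (X x\<^sub>0) \<tau> \<omega>) < min (f x\<^sub>0) (g x\<^sub>0)"
        using inf unfolding region INF_less_iff less_ereal.simps by blast
      have "ereal (max (?f x\<^sub>0) (?g x\<^sub>0)) < ereal (LINT \<omega>|M x\<^sub>0. discounted r ?f (X x\<^sub>0) \<tau> \<omega>)"
        using gain by (auto simp: discounted_uminus)
      also have "\<dots> \<le> (SUP \<tau>\<in>?T. ereal (LINT \<omega>|M x\<^sub>0. discounted r ?f (X x\<^sub>0) \<tau> \<omega>))"
        using \<tau> by (rule SUP_upper)
      finally show "ereal (max (?f x\<^sub>0) (?g x\<^sub>0)) <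
          (SUP \<tau>\<in>?T. ereal (LINT \<omega>|M x\<^sub>0. discounted r ?f (X x\<^sub>0) \<tau> \<omega>))" .
    qed (use proc E D(1) assms(11-13) x\<^sub>0 in \<open>auto intro: continuous_on_minus\<close>)
  qed
qed

end
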